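(* Consider the switched discrete-time system $$x[k+1]=Ax[k]+\sigma[k]Bu[k]+(1-\sigma[k])d[k]+w[k],\qquad y[k]=x[k]+v[k],$$ with $x[k]\in\mathbb{R}^n$, $u[k]\in\mathbb{R}^m$, $d[k]\in\mathcal{D}$, $w[k]\in\mathcal{W}$, $v[k]\in\mathcal{V}$ arbitrary within their sets, $\sigma[k]\in\{0,1\}$, and sets $\mathcal{U}$, $\mathcal{S}\subset\mathcal{X}$ satisfying the standing assumptions in the context. Let $(A_K,B_K,C_K,D_K)$ be a controller realization with state dimension $n_K$ such that $A_{CL}=\begin{bmatrix}A+BD_K & BC_K\\ B_K & A_K\end{bmatrix}$ is Schur, and let polyhedral $\Omega_I\subset\mathbb{R}^n$, $\Omega_O\subset\mathbb{R}^{n+n_K}$ containing the respective origins satisfy I1)–I3) and O1)–O4) (with respect to this realization). Let $\mathbf{K}(z):=C_K(zI_{n_K}-A_K)^{-1}B_K+D_K$, and let $(A_K',B_K',C_K',D_K')$ be any other state-space realization of $\mathbf{K}(z)$ (of any state dimension). Then, if $x[k_0]\in\mathcal{S}_c$ and Algorithm 1 is applied with its Control step (and its controller-state resets to zero) using the realization $(A_K',B_K',C_K',D_K')$ instead of $(A_K,B_K,C_K,D_K)$, the following still hold: (a) $x[k]\in\mathcal{X}$ and $u[k]\in\mathcal{U}$ for all $k\ge k_0$; (b) there exists $T_{\max}\in\mathbb{N}_{>0}$ such that if $\sigma[k_0]=1$ then $\sigma[k_0+T_0]=0$ for some $T_0\in\{1,\dots,T_{\max}\}$, and for every $k>k_0$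 with $\sigma[k]=1$, $\sigma[k-1]=0$, there is $T\in\{1,\dots,T_{\max}\}$ with $\sigma[k+T]=0$; (c) for all $k\ge k_0$, $\sigma[k]=0$ implies $x[k]\in\mathcal{S}$.
   Context: Notation: $\oplus$ Minkowski sum, $\ominus$ Pontryagin difference, $(-\mathcal{X})=\{-x:x\in\mathcal{X}\}$, $\mathrm{conv}$ convex hull, $\|\cdot\|$ Euclidean / induced 2-norm. Standing assumptions: $\mathcal{D},\mathcal{W},\mathcal{V},\mathcal{S},\mathcal{X}\subset\mathbb{R}^n$ and $\mathcal{U}\subset\mathbb{R}^m$ are polytopes containing the origin in their interiors; $\mathcal{S}\subset\mathcal{X}$; there exist $\varepsilon_p,\varepsilon_m\in(0,1)$ with $\mathcal{V}\subseteq\varepsilon_p\mathcal{S}$, $(-\mathcal{V})\subseteq\varepsilon_m\mathcal{S}$; some closed Euclidean ball of positive radius centered at $0$ lies in $\mathcal{S}$; $\mathcal{S}^+:=A\mathcal{S}\oplus\mathcal{W}\oplus\mathcal{D}\subseteq\mathcal{X}$. Define $\mathcal{S}_c:=\mathrm{conv}(\mathcal{S},\mathcal{S}^+)$, $\mathcal{Z}:=\mathcal{W}\times\mathcal{V}$, $\mathcal{N}:=(-\mathcal{V})\oplus\mathcal{V}$, $B_{CL}=\begin{bmatrix}I_n & BD_K\\ O & B_K\end{bmatrix}$, $C_{CL}=[D_K\ C_K]$, $D_{CL}=[O\ D_K]$. Conditions: I1) $\Omega_I\subseteq\varepsilon_s\mathcal{S}$ for a given $\varepsilon_s\in(0,1)$;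 I2) there is $\alpha>0$ with $\{r:\|r\|\le\alpha\}\subseteq\Omega_I\ominus\mathcal{N}$; I3) there is $\beta\in(0,1)$ with $\bigoplus_{i=0}^N[I_n\ O]A_{CL}^iB_{CL}\mathcal{Z}\subseteq\beta(\Omega_I\ominus\mathcal{N})$ for all $N\in\mathbb{N}$; O1) $\mathcal{S}_c\times\{0_{n_K}\}\subseteq\Omega_O$; O2) $A_{CL}\Omega_O\oplus B_{CL}\mathcal{Z}\subseteq\Omega_O$; O3) $[I_n\ O]\Omega_O\subseteq\mathcal{X}$; O4) $C_{CL}\Omega_O\oplus D_{CL}\mathcal{Z}\subseteq\mathcal{U}$. Algorithm 1 (with a controller realization $(\hat A,\hat B,\hat C,\hat D)$ of state $\hat x_K$). Initialization: read $y[k_0]$; if $y[k_0]\in\mathcal{S}\ominus(-\mathcal{V})$, set $\sigma[k_0]=0$, $u[k_0]=0$, $k=k_0+1$, go to Monitoring; else set $k=k_0$, $\sigma[k]=1$, $\hat x_K[k]=0$, go to Control. Monitoring: read $y[k]$. If $y[k]\in\mathcal{S}\ominus(-\mathcal{V})$: if $\sigma[k-1]=1$ and $y[k]\notin\Omega_I\ominus(-\mathcal{V})$, set $\sigma[k]=1$ and go to Control; else set $\sigma[k]=0$, $u[k]=0$, increment $k$, go to Monitoring. Otherwise: if $\sigma[k-1]=0$ set $\hat x_K[k]=0$; set $\sigma[k]=1$ and go to Control. Control: $u[k]=\hat C\hat x_K[k]+\hat D y[k]$, $\hat x_K[k+1]=\hat A\hat x_K[k]+\hat By[k]$, increment $k$,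 go to Monitoring. *)

theory Defs
  imports "HOL-Analysis.Analysis"
begin

text \<open>Minkowski sum, Pontryagin difference.\<close>
definition msum :: "'a::ab_group_add set \<Rightarrow> 'a set \<Rightarrow> 'a set" (infixl "\<oplus>\<^sub>M" 65) where
  "A \<oplus>\<^sub>M B = {a + b | a b. a \<in> A \<and> b \<in> B}"

definition pdiff :: "'a::ab_group_add set \<Rightarrow> 'a set \<Rightarrow> 'a set" (infixl "\<ominus>\<^sub>P" 65) where
  "A \<ominus>\<^sub>P B = {x. \<forall>b\<in>B. x + b \<in> A}"

text \<open>Iterated Minkowski sum  F 0 + ... + F N.\<close>
fun msums :: "(nat \<Rightarrow> 'a::ab_group_add set) \<Rightarrow> nat \<Rightarrow> 'a set" where
  "msums F 0 = F 0"
| "msums F (Suc N) = msums F N \<oplus>\<^sub>M F (Suc N)"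

text \<open>Complexification of a real matrix.\<close>
definition cmat :: "real^'c^'r \<Rightarrow> complex^'c^'r" where
  "cmat M = (\<chi> i j. complex_of_real (M $ i $ j))"

text \<open>Schur matrix: every (complex) eigenvalue lies in the open unit disc.\<close>
definition schur :: "real^'n^'n \<Rightarrow> bool" where
  "schur M \<longleftrightarrow> (\<forall>lam::complex. det (mat lam - cmat M) = 0 \<longrightarrow> cmod lam < 1)"

text \<open>Transfer matrix  K(z) = C_K (z I - A_K)^{-1} B_K + D_K .\<close>
definition tf :: "real^'k^'k \<Rightarrow> real^'n^'k \<Rightarrow> real^'k^'m \<Rightarrow> real^'n^'m \<Rightarrow> complex \<Rightarrow> complex^'n^'m" where
  "tf AK BK CK DK z = cmat CK ** matrix_inv (mat z - cmat AK) ** cmat BK + cmat DK"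

text \<open>Two realizations realize the same transfer matrix (equality as rational
  matrix functions, i.e. equality wherever both are defined).\<close>
definition same_tf ::
  "real^'k^'k \<Rightarrow> real^'n^'k \<Rightarrow> real^'k^'m \<Rightarrow> real^'n^'m \<Rightarrow>
   real^'l^'l \<Rightarrow> real^'n^'l \<Rightarrow> real^'l^'m \<Rightarrow> real^'n^'m \<Rightarrow> bool" where
  "same_tf AK BK CK DK AK' BK' CK' DK' \<longleftrightarrow>
     (\<forall>z. det (mat z - cmat AK) \<noteq> 0 \<longrightarrow> det (mat z - cmat AK') \<noteq> 0 \<longrightarrow>
          tf AK BK CK DK z = tf AK' BK' CK' DK' z)"

text \<open>Closed-loop matrices; the closed-loop state space R^(n+n_K) is indexed by 'n + 'k.\<close>
definition ACL :: "real^'n^'n \<Rightarrow> real^'m^'n \<Rightarrow> real^'k^'k \<Rightarrow> real^'n^'k \<Rightarrow> real^'k^'m \<Rightarrow> real^'n^'m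
                   \<Rightarrow> real^('n + 'k)^('n + 'k)" where
  "ACL A B AK BK CK DK = (\<chi> r c. case r of
       Inl i \<Rightarrow> (case c of Inl j \<Rightarrow> (A + B ** DK) $ i $ j | Inr j \<Rightarrow> (B ** CK) $ i $ j)
     | Inr i \<Rightarrow> (case c of Inl j \<Rightarrow> BK $ i $ j | Inr j \<Rightarrow> AK $ i $ j))"

text \<open>Stacking [x; xK] and projection [I_n O].\<close>
definition stack :: "real^'n::finite \<Rightarrow> real^'k::finite \<Rightarrow> real^('n + 'k)" where
  "stack x xk = (\<chi> r. case r of Inl i \<Rightarrow> x $ i | Inr j \<Rightarrow> xk $ j)"

definition projx :: "real^('n::finite + 'k::finite) \<Rightarrow> real^'n" where
  "projx z = (\<chi> i. z $ Inl i)"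

definition projk :: "real^('n::finite + 'k::finite) \<Rightarrow> real^'k" where
  "projk z = (\<chi> j. z $ Inr j)"

text \<open>B_CL [w; v] = [w + B D_K v; B_K v],  C_CL xi = D_K x + C_K xK,  D_CL [w; v] = D_K v.\<close>
definition BCL :: "real^'m^'n \<Rightarrow> real^'n^'k \<Rightarrow> real^'n^'m \<Rightarrow> (real^'n) \<times> (real^'n) \<Rightarrow> real^('n + 'k)" where
  "BCL B BK DK wv = stack (fst wv + B *v (DK *v snd wv)) (BK *v snd wv)"

definition CCL :: "real^'k^'m \<Rightarrow> real^'n^'m \<Rightarrow> real^('n + 'k) \<Rightarrow> real^'m" where
  "CCL CK DK z = DK *v projx z + CK *v projk z"

definition DCL :: "real^'n^'m \<Rightarrow> (real^'n) \<times> (real^'n) \<Rightarrow> real^'m" where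
  "DCL DK wv = DK *v snd wv"

text \<open>Algorithm 1 with controller realization (Ah,Bh,Ch,Dh), started at time k0.
  sg k = 1 means sigma[k] = 1.  In the Control step the controller state at time k+1
  is updated; when sigma[k] = 0 the algorithm leaves xh unconstrained (it is reset
  before next use).\<close>
definition algorithm1 ::
  "(real^'n) set \<Rightarrow> (real^'n) set \<Rightarrow> (real^'n) set \<Rightarrow>
   real^'l^'l \<Rightarrow> real^'n^'l \<Rightarrow> real^'l^'m \<Rightarrow> real^'n^'m \<Rightarrow>
   nat \<Rightarrow> (nat \<Rightarrow> real^'n) \<Rightarrow> (nat \<Rightarrow> nat) \<Rightarrow> (nat \<Rightarrow> real^'m) \<Rightarrow> (nat \<Rightarrow> real^'l) \<Rightarrow> bool" where
  "algorithm1 S V OmI Ah Bh Ch Dh k0 y sg u xh \<longleftrightarrow>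
     (y k0 \<in> S \<ominus>\<^sub>P (uminus ` V) \<longrightarrow> sg k0 = 0 \<and> u k0 = 0) \<and>
     (y k0 \<notin> S \<ominus>\<^sub>P (uminus ` V) \<longrightarrow> sg k0 = 1 \<and> xh k0 = 0) \<and>
     (\<forall>k>k0.
        (if y k \<in> S \<ominus>\<^sub>P (uminus ` V) then
           (if sg (k - 1) = 1 \<and> y k \<notin> OmI \<ominus>\<^sub>P (uminus ` V) then sg k = 1
            else sg k = 0 \<and> u k = 0)
         else (sg (k - 1) = 0 \<longrightarrow> xh k = 0) \<and> sg k = 1)) \<and>
     (\<forall>k\<ge>k0. sg k = 1 \<longrightarrow>
        u k = Ch *v xh k + Dh *v y k \<and> xh (Suc k) = Ah *v xh k + Bh *v y k)"

text \<open>Plant: x[k+1] = A x + sigma B u + (1 - sigma) d + w,  y = x + v, disturbances in their sets.\<close>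
definition plant ::
  "real^'n^'n \<Rightarrow> real^'m^'n \<Rightarrow> (real^'n) set \<Rightarrow> (real^'n) set \<Rightarrow> (real^'n) set \<Rightarrow> nat \<Rightarrow>
   (nat \<Rightarrow> real^'n) \<Rightarrow> (nat \<Rightarrow> real^'n) \<Rightarrow> (nat \<Rightarrow> nat) \<Rightarrow> (nat \<Rightarrow> real^'m) \<Rightarrow>
   (nat \<Rightarrow> real^'n) \<Rightarrow> (nat \<Rightarrow> real^'n) \<Rightarrow> (nat \<Rightarrow> real^'n) \<Rightarrow> bool" where
  "plant A B D W V k0 x y sg u d w v \<longleftrightarrow>
     (\<forall>k\<ge>k0. d k \<in> D \<and> w k \<in> W \<and> v k \<in> V \<and> y k = x k + v k \<and>
        x (Suc k) = A *v x k + real (sg k) *\<^sub>R (B *v u k) + (1 - real (sg k)) *\<^sub>R d k + w k)"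

end

theory Submission
  imports "Jordan_Normal_Form.Spectral_Radius" Defs
begin

text \<open>
  Two realizations of the same transfer matrix have the same Markov parameters: the feedthrough
  \<open>D\<^sub>K = D\<^sub>K'\<close> and \<open>C\<^sub>K A\<^sub>K\<^sup>N B\<^sub>K = C\<^sub>K' A\<^sub>K'\<^sup>N B\<^sub>K'\<close>, which are the coefficients of the
  expansion of \<open>K(t)\<close> at \<open>t = \<infinity>\<close>. Every control episode of Algorithm 1 starts with the controller
  state reset to zero, so the inputs it produces depend on the realization only through these
  parameters. Hence during an episode the plant state, stacked with the state that the original
  realization would have if it had been started at zero, follows the original closed loop
  \<open>\<xi>\<^sup>+ = A\<^sub>C\<^sub>L \<xi> + B\<^sub>C\<^sub>L (w, v)\<close> from \<open>(x, 0)\<close> with \<open>x \<in> S\<^sub>c\<close>, and O1-O4 keep state and input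
  admissible. Since \<open>A\<^sub>C\<^sub>L\<close> is Schur, after some \<open>N\<close> steps the free response from the bounded set
  \<open>S\<^sub>c\<close> is smaller than \<open>\<alpha> (1 - \<beta>)\<close>; by I2, I3 and convexity the state then lies in
  \<open>\<Omega>\<^sub>I \<ominus> ((-V) \<oplus> V)\<close>, the measurement in \<open>\<Omega>\<^sub>I \<ominus> (-V)\<close>, and the algorithm returns to monitoring.
  While monitoring, \<open>y \<in> S \<ominus> (-V)\<close> forces \<open>x \<in> S\<close>.
\<close>

section \<open>Matrices of the Jordan normal form library\<close>

text \<open>That library is only used for its bound on the powers of a matrix of spectral radius
  below 1; its notation for vectors, matrices and determinants is hidden in favour of HOL-Analysis.\<close>

no_notation Matrix.vec_index (infixl "$" 100)
no_notation Matrix.scalar_prod (infix "\<bullet>" 70)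
hide_const (open) Matrix.mat Determinant.det

definition enum_index :: "nat \<Rightarrow> 'a::finite" where
  "enum_index = (SOME h. bij_betw h {0..<CARD('a)} UNIV)"

lemma bij_enum_index: "bij_betw (enum_index :: nat \<Rightarrow> 'a::finite) {0..<CARD('a)} UNIV"
proof -
  have "\<exists>h. bij_betw h {0..<CARD('a)} (UNIV :: 'a set)"
    using ex_bij_betw_nat_finite[of "UNIV :: 'a set"] by simp
  then show ?thesis unfolding enum_index_def by (rule someI_ex)
qed

lemma enum_index_surj: "\<exists>i<CARD('a). (a::'a::finite) = enum_index i"
  using bij_enum_index[where 'a='a] unfolding bij_betw_def by (metis UNIV_I atLeastLessThan_iff imageE)

lemma sum_enum_index: "(\<Sum>i<CARD('a). f (enum_index i)) = (\<Sum>a\<in>(UNIV::'a::finite set). f a)"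
  using sum.reindex_bij_betw[OF bij_enum_index, of f] by (simp add: atLeast0LessThan)

definition jnf_mat :: "'b^'a^'a::finite \<Rightarrow> 'b Matrix.mat" where
  "jnf_mat M = Matrix.mat CARD('a) CARD('a) (\<lambda>(i, j). M $ enum_index i $ enum_index j)"

definition jnf_vec :: "'b^'a::finite \<Rightarrow> 'b Matrix.vec" where
  "jnf_vec x = Matrix.vec CARD('a) (\<lambda>i. x $ enum_index i)"

lemma jnf_mat_carrier [simp]: "jnf_mat (M :: 'b^'a^'a::finite) \<in> carrier_mat CARD('a) CARD('a)"
  by (simp add: jnf_mat_def)

lemma jnf_mat_dim [simp]:
  "dim_row (jnf_mat (M :: 'b^'a^'a::finite)) = CARD('a)" "dim_col (jnf_mat M) = CARD('a)"
  by (simp_all add: jnf_mat_def)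

lemma jnf_mat_index [simp]:
  "i < CARD('a) \<Longrightarrow> j < CARD('a) \<Longrightarrow> jnf_mat (M :: 'b^'a^'a::finite) $$ (i, j) = M $ enum_index i $ enum_index j"
  by (simp add: jnf_mat_def)

lemma jnf_vec_carrier [simp]: "jnf_vec (x :: 'b^'a::finite) \<in> carrier_vec CARD('a)"
  by (simp add: jnf_vec_def)

lemma jnf_vec_index [simp]: "i < CARD('a) \<Longrightarrow> vec_index (jnf_vec (x :: 'b^'a::finite)) i = x $ enum_index i"
  by (simp add: jnf_vec_def)

lemma jnf_vec_inject [simp]: "jnf_vec x = jnf_vec y \<longleftrightarrow> x = (y :: 'b^'a::finite)"
proof
  assume eq: "jnf_vec x = jnf_vec y"
  have "x $ a = y $ a" for a
  proof -
    obtain i where "i < CARD('a)" "a = enum_index i" using enum_index_surj[of a] by blast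
    then show ?thesis using arg_cong[OF eq, of "\<lambda>v. vec_index v i"] by simp
  qed
  then show "x = y" by (simp add: vec_eq_iff)
qed simp

lemma jnf_vec_surj:
  assumes "v \<in> carrier_vec CARD('a)"
  obtains x :: "'b^'a::finite" where "v = jnf_vec x"
proof
  let ?g = "the_inv_into {0..<CARD('a)} (enum_index :: nat \<Rightarrow> 'a)"
  show "v = jnf_vec (\<chi> a. vec_index v (?g a))"
  proof (rule eq_vecI)
    fix i assume "i < dim_vec (jnf_vec (\<chi> a. vec_index v (?g a)))"
    then have i: "i < CARD('a)" by (simp add: jnf_vec_def)
    then have "?g (enum_index i) = i"
      using bij_enum_index[where 'a='a] by (simp add: bij_betw_def the_inv_into_f_f)
    then show "vec_index v i = vec_index (jnf_vec (\<chi> a. vec_index v (?g a))) i" using i by simp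
  qed (use assms in \<open>simp add: jnf_vec_def\<close>)
qed

lemma jnf_vec_zero [simp]: "jnf_vec (0 :: 'b::zero^'a::finite) = 0\<^sub>v CARD('a)"
  by (rule eq_vecI) (auto simp: jnf_vec_def)

lemma jnf_vec_smult: "jnf_vec (c *s x) = c \<cdot>\<^sub>v jnf_vec (x :: 'b::times^'a::finite)"
  by (rule eq_vecI) (auto simp: jnf_vec_def)

lemma jnf_mat_mult_vec:
  fixes M :: "'b::comm_semiring_1^'a^'a::finite"
  shows "jnf_mat M *\<^sub>v jnf_vec x = jnf_vec (M *v x)"
proof (rule eq_vecI)
  fix i assume "i < dim_vec (jnf_vec (M *v x))"
  then have i: "i < CARD('a)" by (simp add: jnf_vec_def)
  have "vec_index (jnf_mat M *\<^sub>v jnf_vec x) i = (\<Sum>j<CARD('a). M $ enum_index i $ enum_index j * x $ enum_index j)"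
    using i by (simp add: jnf_mat_def jnf_vec_def scalar_prod_def atLeast0LessThan)
  also have "\<dots> = vec_index (jnf_vec (M *v x)) i"
    using i by (simp add: sum_enum_index[of "\<lambda>b. M $ enum_index i $ b * x $ b"] matrix_vector_mult_def)
  finally show "vec_index (jnf_mat M *\<^sub>v jnf_vec x) i = vec_index (jnf_vec (M *v x)) i" .
qed (simp add: jnf_mat_def jnf_vec_def)

lemma jnf_mat_mult:
  fixes M N :: "'b::comm_semiring_1^'a^'a::finite"
  shows "jnf_mat (M ** N) = jnf_mat M * jnf_mat N"
proof (rule eq_matI)
  fix i j assume "i < dim_row (jnf_mat M * jnf_mat N)" "j < dim_col (jnf_mat M * jnf_mat N)"
  then have ij: "i < CARD('a)" "j < CARD('a)" by auto
  have "(jnf_mat M * jnf_mat N) $$ (i, j) = (\<Sum>k<CARD('a). M $ enum_index i $ enum_index k * N $ enum_index k $ enum_index j)"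
    using ij by (simp add: jnf_mat_def scalar_prod_def atLeast0LessThan)
  also have "\<dots> = jnf_mat (M ** N) $$ (i, j)"
    using ij by (simp add: sum_enum_index[of "\<lambda>b. M $ enum_index i $ b * N $ b $ enum_index j"] matrix_matrix_mult_def)
  finally show "jnf_mat (M ** N) $$ (i, j) = (jnf_mat M * jnf_mat N) $$ (i, j)" by simp
qed auto

lemma jnf_mat_one: "jnf_mat (mat 1 :: 'b::{zero,one}^'a^'a::finite) = 1\<^sub>m CARD('a)"
proof (rule eq_matI)
  fix i j assume "i < dim_row (1\<^sub>m CARD('a))" "j < dim_col (1\<^sub>m CARD('a) :: 'b Matrix.mat)"
  then have ij: "i < CARD('a)" "j < CARD('a)" by auto
  have "enum_index i = (enum_index j :: 'a) \<longleftrightarrow> i = j"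
    using bij_enum_index[where 'a='a] ij by (auto simp: bij_betw_def inj_on_def)
  then show "jnf_mat (mat 1 :: 'b^'a^'a) $$ (i, j) = 1\<^sub>m CARD('a) $$ (i, j)"
    using ij by (simp add: mat_def)
qed auto

lemma mat_mult_vec: "mat c *v x = c *s (x :: 'a::comm_semiring_1^'n)"
proof -
  have "(if i = j then c else 0) * x $ j = (if i = j then c * x $ j else 0)" for i j
    by simp
  then show ?thesis
    by (simp add: vec_eq_iff matrix_vector_mult_def mat_def sum.delta)
qed

lemma det_eq_0_iff_eigenvector:
  fixes M :: "'a::field^'n^'n"
  shows "det (mat lam - M) = 0 \<longleftrightarrow> (\<exists>x. x \<noteq> 0 \<and> M *v x = lam *s x)"
proof -
  have "det (mat lam - M) = 0 \<longleftrightarrow>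
      \<not> invertible (mat lam - M)"
    by (simp add: invertible_det_nz)
  also have "\<dots> \<longleftrightarrow> (\<exists>x. x \<noteq> 0 \<and> (mat lam - M) *v x = 0)"
    unfolding invertible_left_inverse matrix_left_invertible_ker by blast
  also have "\<dots> \<longleftrightarrow> (\<exists>x. x \<noteq> 0 \<and> M *v x = lam *s x)"
    by (simp add: matrix_vector_mult_diff_rdistrib mat_mult_vec) metis
  finally show ?thesis .
qed

lemma eigenvalue_jnf_mat_iff:
  fixes M :: "'b::field^'a^'a::finite"
  shows "eigenvalue (jnf_mat M) lam \<longleftrightarrow> det (mat lam - M) = 0"
proof -
  have nonzero: "jnf_vec x \<noteq> 0\<^sub>v CARD('a) \<longleftrightarrow> x \<noteq> 0" for x :: "'b^'a"
    using jnf_vec_inject[of x 0] by simp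
  have eigen: "jnf_mat M *\<^sub>v jnf_vec x = lam \<cdot>\<^sub>v jnf_vec x \<longleftrightarrow> M *v x = lam *s x" for x
    by (simp add: jnf_mat_mult_vec flip: jnf_vec_smult)
  have "eigenvalue (jnf_mat M) lam \<longleftrightarrow> (\<exists>x. x \<noteq> 0 \<and> M *v x = lam *s x)"
  proof
    assume "eigenvalue (jnf_mat M) lam"
    then obtain v where v: "v \<in> carrier_vec CARD('a)" "v \<noteq> 0\<^sub>v CARD('a)" "jnf_mat M *\<^sub>v v = lam \<cdot>\<^sub>v v"
      unfolding eigenvalue_def eigenvector_def by auto
    obtain x :: "'b^'a" where x: "v = jnf_vec x" by (rule jnf_vec_surj[OF v(1)])
    have "x \<noteq> 0" "M *v x = lam *s x"
      using v(2,3) unfolding x nonzero eigen .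
    then show "\<exists>x. x \<noteq> 0 \<and> M *v x = lam *s x" by blast
  next
    assume "\<exists>x. x \<noteq> 0 \<and> M *v x = lam *s x"
    then obtain x where "x \<noteq> 0" "M *v x = lam *s x" by blast
    then have "eigenvector (jnf_mat M) (jnf_vec x) lam"
      unfolding eigenvector_def nonzero[symmetric] eigen[symmetric] by simp
    then show "eigenvalue (jnf_mat M) lam" unfolding eigenvalue_def by blast
  qed
  then show ?thesis by (simp add: det_eq_0_iff_eigenvector)
qed

section \<open>Decay of Schur matrices\<close>

fun matpow :: "'a::semiring_1^'n^'n \<Rightarrow> nat \<Rightarrow> 'a^'n^'n" where
  "matpow M 0 = mat 1"
| "matpow M (Suc k) = matpow M k ** M"

lemma matpow_mult_vec: "matpow M k *v x = (((*v) M) ^^ k) x"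
  for M :: "'a::semiring_1^'n^'n"
  by (induction k arbitrary: x) (simp_all add: funpow_Suc_right matrix_vector_mul_assoc[symmetric] del: funpow.simps)

lemma jnf_mat_matpow: "jnf_mat (matpow M k) = jnf_mat M ^\<^sub>m k"
  for M :: "'b::comm_semiring_1^'a^'a::finite"
  by (induction k) (simp_all add: jnf_mat_one jnf_mat_mult)

definition cvec :: "real^'n \<Rightarrow> complex^'n" where
  "cvec x = (\<chi> i. complex_of_real (x $ i))"

lemma cvec_inject [simp]: "cvec x = cvec y \<longleftrightarrow> x = y"
  by (simp add: cvec_def vec_eq_iff)

lemma cmat_mult_cvec: "cmat M *v cvec x = cvec (M *v x)"
  by (simp add: vec_eq_iff cmat_def cvec_def matrix_vector_mult_def)

lemma cmat_funpow_cvec: "(((*v) (cmat M)) ^^ k) (cvec x) = cvec ((((*v) M) ^^ k) x)"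
  for M :: "real^'n^'n"
  by (induction k) (simp_all add: cmat_mult_cvec)

lemma cmat_matrix_mult: "cmat (M ** N) = cmat M ** cmat N"
  by (simp add: vec_eq_iff cmat_def matrix_matrix_mult_def)

lemma cmat_matpow: "cmat (matpow M k) = matpow (cmat M) k"
  by (induction k) (simp_all add: cmat_matrix_mult, simp add: vec_eq_iff cmat_def mat_def)

lemma cmat_scaleR_mult: "cmat (c *\<^sub>R M) *v z = complex_of_real c *s (cmat M *v z)"
  by (simp add: vec_eq_iff cmat_def matrix_vector_mult_def sum_distrib_left mult.assoc)

lemma spectral_radius_jnf_mat_mem: "spectral_radius (jnf_mat M) \<in> cmod ` spectrum (jnf_mat M)"
  for M :: "complex^'a^'a::finite"
  by (rule spectral_radius_mem_max(1)[OF jnf_mat_carrier]) simp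

lemma spectral_radius_less_1_if_schur:
  assumes "schur M"
  shows "spectral_radius (jnf_mat (cmat M)) < 1"
proof -
  obtain ev where "ev \<in> spectrum (jnf_mat (cmat M))" "spectral_radius (jnf_mat (cmat M)) = cmod ev"
    using spectral_radius_jnf_mat_mem by blast
  then show ?thesis
    using assms unfolding schur_def spectrum_def by (simp add: eigenvalue_jnf_mat_iff)
qed

lemma schur_power_bounded:
  fixes M :: "real^'n^'n"
  assumes "schur M"
  obtains c where "\<And>k x. norm ((((*v) M) ^^ k) x) \<le> c * norm x"
proof -
  obtain c where c: "\<And>k. norm_bound (jnf_mat (cmat M) ^\<^sub>m k) c"
    using spectral_radius_jnf_norm_bound_less_1_upper_triangular[OF jnf_mat_carrier
        spectral_radius_less_1_if_schur[OF assms]] by blast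
  have entries: "\<bar>matpow M k $ a $ b\<bar> \<le> c" for k a b
  proof -
    obtain i j where ij: "i < CARD('n)" "a = enum_index i" "j < CARD('n)" "b = enum_index j"
      using enum_index_surj[of a] enum_index_surj[of b] by blast
    have "\<bar>matpow M k $ a $ b\<bar> = cmod (cmat (matpow M k) $ a $ b)"
      by (simp add: cmat_def)
    also have "\<dots> = cmod (jnf_mat (cmat (matpow M k)) $$ (i, j))"
      using ij by simp
    also have "\<dots> = cmod ((jnf_mat (cmat M) ^\<^sub>m k) $$ (i, j))"
      by (simp only: cmat_matpow jnf_mat_matpow)
    also have "\<dots> \<le> c"
      using c[of k] ij by (simp add: norm_bound_def)
    finally show ?thesis .
  qed
  have "norm ((((*v) M) ^^ k) x) \<le> (CARD('n) * CARD('n) * c) * norm x" for k x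
  proof -
    have "norm ((((*v) M) ^^ k) x) \<le> onorm ((*v) (matpow M k)) * norm x"
      unfolding matpow_mult_vec[symmetric] by (rule onorm) simp
    also have "\<dots> \<le> (CARD('n) * CARD('n) * c) * norm x"
      using onorm_le_matrix_component[of "matpow M k" c] entries by (intro mult_right_mono) auto
    finally show ?thesis .
  qed
  then show thesis by (rule that)
qed

lemma funpow_matrix_scaleR: "(((*v) (c *\<^sub>R M)) ^^ k) x = c ^ k *\<^sub>R ((((*v) M) ^^ k) x)"
  for M :: "real^'n^'n"
  by (induction k) (simp_all add: scaleR_matrix_vector_assoc[symmetric] matrix_vector_mult_scaleR)

lemma schur_rescale:
  fixes M :: "real^'n^'n"
  assumes "schur M"
  obtains r where "0 < r" "r < 1" "schur ((1 / r) *\<^sub>R M)"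
proof
  let ?J = "jnf_mat (cmat M)"
  define r where "r = (1 + spectral_radius ?J) / 2"
  have "spectral_radius ?J \<ge> 0"
    using spectral_radius_jnf_mat_mem[of "cmat M"] by force
  then have r: "0 < r" "r < 1" and gap: "spectral_radius ?J < r"
    using spectral_radius_less_1_if_schur[OF assms] by (auto simp: r_def)
  then show "0 < r" "r < 1" by simp_all
  show "schur ((1 / r) *\<^sub>R M)"
    unfolding schur_def
  proof (intro allI impI)
    fix lam
    assume "det (mat lam - cmat ((1 / r) *\<^sub>R M)) = 0"
    then obtain x where x: "x \<noteq> 0" "cmat ((1 / r) *\<^sub>R M) *v x = lam *s x"
      by (auto simp: det_eq_0_iff_eigenvector)
    have "cmat M *v x = complex_of_real r *s (cmat ((1 / r) *\<^sub>R M) *v x)"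
      using r by (simp add: cmat_scaleR_mult vector_smult_assoc flip: of_real_mult)
    then have "cmat M *v x = (complex_of_real r * lam) *s x"
      by (simp add: x(2) vector_smult_assoc)
    then have "complex_of_real r * lam \<in> spectrum ?J"
      using x(1) by (auto simp: spectrum_def eigenvalue_jnf_mat_iff det_eq_0_iff_eigenvector)
    then have "cmod (complex_of_real r * lam) \<le> spectral_radius ?J"
      by (intro spectral_radius_mem_max(2)[OF jnf_mat_carrier]) simp_all
    then have "r * cmod lam \<le> spectral_radius ?J"
      using r by (simp add: norm_mult)
    then have "r * cmod lam < r * 1"
      using gap by linarith
    then show "cmod lam < 1"
      by (simp only: mult_less_cancel_left_pos[OF r(1)])
  qed
qed

lemma schur_power_decay:
  fixes M :: "real^'n^'n"
  assumes "schur M"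
  obtains c r where "0 < r" "r < 1" "\<And>k x. norm ((((*v) M) ^^ k) x) \<le> c * r ^ k * norm x"
proof -
  obtain r where r: "0 < r" "r < 1" and sch: "schur ((1 / r) *\<^sub>R M)"
    by (rule schur_rescale[OF assms])
  obtain c where c: "\<And>k x. norm ((((*v) ((1 / r) *\<^sub>R M)) ^^ k) x) \<le> c * norm x"
    using schur_power_bounded[OF sch] by metis
  have "norm ((((*v) M) ^^ k) x) \<le> c * r ^ k * norm x" for k x
  proof -
    have "(((*v) M) ^^ k) x = r ^ k *\<^sub>R (((*v) ((1 / r) *\<^sub>R M)) ^^ k) x"
      using r by (simp add: funpow_matrix_scaleR power_one_over)
    then show ?thesis
      using c[of k x] r by (simp add: mult_left_mono mult.commute mult.left_commute)
  qed
  with r that show thesis by blast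
qed

lemma schur_powers_eventually_small:
  fixes M :: "real^'n^'n"
  assumes "schur M" "bounded K" "0 < e"
  obtains N where "0 < N" "\<forall>x\<in>K. norm ((((*v) M) ^^ N) x) \<le> e"
proof -
  obtain c r where r: "0 < r" "r < 1" and c: "\<And>k x. norm ((((*v) M) ^^ k) x) \<le> c * r ^ k * norm x"
    using schur_power_decay[OF assms(1)] by metis
  obtain R where R: "\<And>x. x \<in> K \<Longrightarrow> norm x \<le> R"
    using assms(2) unfolding bounded_iff by blast
  define C where "C = \<bar>c\<bar> * \<bar>R\<bar> + 1"
  have C: "0 < C" by (simp add: C_def add_nonneg_pos)
  obtain n where n: "r ^ n < e / C"
    using real_arch_pow_inv[OF divide_pos_pos[OF assms(3) C] r(2)] by blast
  have "\<forall>x\<in>K. norm ((((*v) M) ^^ Suc n) x) \<le> e"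
  proof
    fix x assume "x \<in> K"
    have "norm ((((*v) M) ^^ Suc n) x) \<le> c * r ^ Suc n * norm x" by (rule c)
    also have "\<dots> \<le> \<bar>c\<bar> * r ^ n * \<bar>R\<bar>"
      using R[OF \<open>x \<in> K\<close>] r
      by (intro mult_mono) (auto simp: abs_le_iff mult_left_le_one_le power_le_one)
    also have "\<dots> \<le> C * r ^ n"
      using r by (simp add: C_def algebra_simps)
    also have "\<dots> \<le> e"
      using n C by (simp add: field_simps)
    finally show "norm ((((*v) M) ^^ Suc n) x) \<le> e" .
  qed
  then show thesis by (intro that[of "Suc n"]) simp_all
qed

section \<open>Markov parameters of a transfer matrix\<close>

definition resolvent :: "complex^'n^'n \<Rightarrow> real \<Rightarrow> complex^'n^'n" where
  "resolvent M t = matrix_inv (mat (complex_of_real t) - M)"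

lemma mat_of_real_mult_vec: "mat (complex_of_real t) *v z = t *\<^sub>R z"
  by (simp add: mat_mult_vec vec_eq_iff, simp add: scaleR_conv_of_real)

lemma resolvent_inverse:
  fixes M :: "complex^'n^'n"
  assumes t: "onorm ((*v) M) < t"
  shows "invertible (mat (complex_of_real t) - M)"
    and "resolvent M t ** (mat (complex_of_real t) - M) = mat 1"
    and "(mat (complex_of_real t) - M) ** resolvent M t = mat 1"
proof -
  let ?E = "mat (complex_of_real t) - M"
  have "x = 0" if "?E *v x = 0" for x
  proof (rule ccontr)
    assume "x \<noteq> 0"
    have t0: "0 < t"
      using onorm_pos_le[OF matrix_vector_mul_bounded_linear, of M] t by linarith
    have "t *\<^sub>R x = M *v x"
      using that by (simp add: matrix_vector_mult_diff_rdistrib mat_of_real_mult_vec)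
    then have "t * norm x = norm (M *v x)"
      using t0 by (metis abs_of_pos norm_scaleR)
    also have "\<dots> \<le> onorm ((*v) M) * norm x"
      by (rule onorm[OF matrix_vector_mul_bounded_linear])
    finally have "t \<le> onorm ((*v) M)"
      using \<open>x \<noteq> 0\<close> by simp
    then show False using t by simp
  qed
  then show "invertible ?E"
    unfolding invertible_left_inverse matrix_left_invertible_ker by blast
  then have "?E ** resolvent M t = mat 1 \<and> resolvent M t ** ?E = mat 1"
    unfolding resolvent_def matrix_inv_def invertible_def by (rule someI_ex)
  then show "resolvent M t ** ?E = mat 1" "?E ** resolvent M t = mat 1"
    by blast+
qed

lemma resolvent_identity:
  fixes M :: "complex^'n^'n"
  assumes "onorm ((*v) M) < t"
  shows "t *\<^sub>R (resolvent M t *v z) = z + resolvent M t *v (M *v z)"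
proof -
  let ?E = "mat (complex_of_real t) - M"
  have "resolvent M t *v (?E *v z) = z"
    using resolvent_inverse(2)[OF assms] by (simp add: matrix_vector_mul_assoc)
  moreover have "?E *v z = t *\<^sub>R z - M *v z"
    by (simp add: matrix_vector_mult_diff_rdistrib mat_of_real_mult_vec)
  ultimately have "t *\<^sub>R (resolvent M t *v z) - resolvent M t *v (M *v z) = z"
    by (simp add: linear_diff[OF matrix_vector_mul_linear] linear_scale[OF matrix_vector_mul_linear])
  then show ?thesis by (simp add: diff_eq_eq)
qed

lemma norm_resolvent_le:
  fixes M :: "complex^'n^'n"
  assumes t: "onorm ((*v) M) < t"
  shows "norm (resolvent M t *v z) \<le> norm z / (t - onorm ((*v) M))"
proof -
  let ?x = "resolvent M t *v z" and ?K = "onorm ((*v) M)"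
  have "(mat (complex_of_real t) - M) *v ?x = z"
    using resolvent_inverse(3)[OF t] by (simp add: matrix_vector_mul_assoc)
  then have "t *\<^sub>R ?x - M *v ?x = z"
    by (simp only: matrix_vector_mult_diff_rdistrib mat_of_real_mult_vec)
  then have "t * norm ?x - ?K * norm ?x \<le> norm z"
    using norm_triangle_ineq2[of "t *\<^sub>R ?x" "M *v ?x"] onorm[OF matrix_vector_mul_bounded_linear, of M ?x]
      onorm_pos_le[OF matrix_vector_mul_bounded_linear, of M] t
    by simp
  then show ?thesis
    using t by (simp add: field_simps)
qed

lemma tendsto_const_divide_shift_at_top: "((\<lambda>t::real. c / (t - a)) \<longlongrightarrow> 0) at_top"
proof (rule tendsto_divide_0[OF tendsto_const])
  have "filterlim (\<lambda>t::real. - a + t) at_top at_top"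
    by (rule filterlim_tendsto_add_at_top[OF tendsto_const filterlim_ident])
  then show "filterlim (\<lambda>t::real. t - a) at_infinity at_top"
    by (simp add: filterlim_at_top_imp_at_infinity)
qed

lemma tendsto_resolvent_0: "((\<lambda>t. resolvent M t *v z) \<longlongrightarrow> 0) at_top"
proof (rule Lim_null_comparison)
  show "\<forall>\<^sub>F t in at_top. norm (resolvent M t *v z) \<le> norm z / (t - onorm ((*v) M))"
    using eventually_gt_at_top by (rule eventually_mono) (rule norm_resolvent_le)
qed (rule tendsto_const_divide_shift_at_top)

lemma tendsto_scaled_resolvent: "((\<lambda>t. t *\<^sub>R (resolvent M t *v z)) \<longlongrightarrow> z) at_top"
proof (rule Lim_transform_eventually)
  show "((\<lambda>t. z + resolvent M t *v (M *v z)) \<longlongrightarrow> z) at_top"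
    using tendsto_add[OF tendsto_const tendsto_resolvent_0] by simp
  show "\<forall>\<^sub>F t in at_top. z + resolvent M t *v (M *v z) = t *\<^sub>R (resolvent M t *v z)"
    using eventually_gt_at_top[of "onorm ((*v) M)"] by (rule eventually_mono) (simp add: resolvent_identity)
qed

lemma tendsto_resolvent_tail_0: "((\<lambda>t. C *v (resolvent A t *v z)) \<longlongrightarrow> 0) at_top"
  by (rule bounded_linear.tendsto_zero[OF matrix_vector_mul_bounded_linear tendsto_resolvent_0])

lemma tendsto_scaled_resolvent_tail: "((\<lambda>t. t *\<^sub>R (C *v (resolvent A t *v z))) \<longlongrightarrow> C *v z) at_top"
  using bounded_linear.tendsto[OF matrix_vector_mul_bounded_linear tendsto_scaled_resolvent, of C A z]
  by (simp add: linear_scale[OF matrix_vector_mul_linear])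

lemma resolvent_tail_shift:
  assumes "onorm ((*v) A) < t"
  shows "C *v (resolvent A t *v (A *v z)) = t *\<^sub>R (C *v (resolvent A t *v z)) - C *v z"
  using arg_cong[OF resolvent_identity[OF assms, of z], of "(*v) C"]
  by (simp add: linear_scale[OF matrix_vector_mul_linear] matrix_vector_right_distrib)

lemma markov_parameters_unique:
  fixes A :: "complex^'k^'k" and C :: "complex^'k^'m" and A' :: "complex^'l^'l" and C' :: "complex^'l^'m"
  assumes eq: "\<forall>\<^sub>F t in at_top. C *v (resolvent A t *v z) + d = C' *v (resolvent A' t *v z') + d'"
  shows "d = d'" and "C *v ((((*v) A) ^^ N) z) = C' *v ((((*v) A') ^^ N) z')"
proof -
  have "((\<lambda>t. C *v (resolvent A t *v z) + d) \<longlongrightarrow> d) at_top"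
    using tendsto_add[OF tendsto_resolvent_tail_0 tendsto_const] by simp
  moreover have "((\<lambda>t. C *v (resolvent A t *v z) + d) \<longlongrightarrow> d') at_top"
    using tendsto_add[OF tendsto_resolvent_tail_0 tendsto_const] tendsto_cong[OF eq] by simp
  ultimately show d: "d = d'" by (rule tendsto_unique[OF trivial_limit_at_top_linorder])
  txt \<open>The tails \<open>Q N t = C (t I - A)\<^sup>-\<^sup>1 A\<^sup>N z\<close> satisfy \<open>Q (N + 1) t = t Q N t - C A\<^sup>N z\<close>
    and \<open>t Q N t \<longrightarrow> C A\<^sup>N z\<close>, so eventual equality propagates from \<open>Q 0\<close> to every \<open>Q N\<close>
    and yields the Markov parameters one at a time.\<close>
  define Q where "Q N t = C *v (resolvent A t *v ((((*v) A) ^^ N) z))" for N t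
  define Q' where "Q' N t = C' *v (resolvent A' t *v ((((*v) A') ^^ N) z'))" for N t
  have markov: "C *v ((((*v) A) ^^ N) z) = C' *v ((((*v) A') ^^ N) z')"
    if "\<forall>\<^sub>F t in at_top. Q N t = Q' N t" for N
  proof (rule tendsto_unique[OF trivial_limit_at_top_linorder])
    show "((\<lambda>t. t *\<^sub>R Q N t) \<longlongrightarrow> C *v ((((*v) A) ^^ N) z)) at_top"
      unfolding Q_def by (rule tendsto_scaled_resolvent_tail)
    have ev: "\<forall>\<^sub>F t in at_top. t *\<^sub>R Q' N t = t *\<^sub>R Q N t"
      using that by (rule eventually_mono) simp
    have "((\<lambda>t. t *\<^sub>R Q' N t) \<longlongrightarrow> C' *v ((((*v) A') ^^ N) z')) at_top"
      unfolding Q'_def by (rule tendsto_scaled_resolvent_tail)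
    then show "((\<lambda>t. t *\<^sub>R Q N t) \<longlongrightarrow> C' *v ((((*v) A') ^^ N) z')) at_top"
      by (rule iffD1[OF tendsto_cong[OF ev]])
  qed
  have "\<forall>\<^sub>F t in at_top. Q N t = Q' N t" for N
  proof (induction N)
    case 0
    show ?case using eq by (rule eventually_mono) (simp add: Q_def Q'_def d)
  next
    case (Suc N)
    have "\<forall>\<^sub>F t in at_top. Q N t = Q' N t \<and> onorm ((*v) A) < t \<and> onorm ((*v) A') < t"
      using Suc eventually_gt_at_top eventually_gt_at_top by (intro eventually_conj)
    then show ?case
      by (rule eventually_mono) (simp add: Q_def Q'_def resolvent_tail_shift markov[OF Suc, unfolded Q_def Q'_def])
  qed
  then show "C *v ((((*v) A) ^^ N) z) = C' *v ((((*v) A') ^^ N) z')" by (rule markov)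
qed

lemma tf_mult_cvec:
  "tf AK BK CK DK (complex_of_real t) *v cvec b =
    cmat CK *v (resolvent (cmat AK) t *v cvec (BK *v b)) + cvec (DK *v b)"
  by (simp add: tf_def resolvent_def matrix_vector_mult_add_rdistrib flip: cmat_mult_cvec matrix_vector_mul_assoc)

lemma same_tf_imp_markov:
  fixes AK :: "real^'k^'k" and BK :: "real^'n^'k" and CK :: "real^'k^'m" and DK :: "real^'n^'m"
    and AK' :: "real^'l^'l" and BK' :: "real^'n^'l" and CK' :: "real^'l^'m" and DK' :: "real^'n^'m"
  assumes "same_tf AK BK CK DK AK' BK' CK' DK'"
  shows "DK' = DK" and "CK' *v ((((*v) AK') ^^ N) (BK' *v b)) = CK *v ((((*v) AK) ^^ N) (BK *v b))"
proof -
  have eq: "\<forall>\<^sub>F t in at_top.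
      cmat CK *v (resolvent (cmat AK) t *v cvec (BK *v b)) + cvec (DK *v b) =
      cmat CK' *v (resolvent (cmat AK') t *v cvec (BK' *v b)) + cvec (DK' *v b)" for b
    using eventually_gt_at_top eventually_gt_at_top
  proof (rule eventually_elim2)
    fix t assume "onorm ((*v) (cmat AK)) < t" "onorm ((*v) (cmat AK')) < t"
    then have "det (mat (complex_of_real t) - cmat AK) \<noteq> 0"
      "det (mat (complex_of_real t) - cmat AK') \<noteq> 0"
      using resolvent_inverse(1) by (simp_all add: invertible_det_nz)
    then have tf_eq: "tf AK BK CK DK (complex_of_real t) = tf AK' BK' CK' DK' (complex_of_real t)"
      using assms unfolding same_tf_def by blast
    show "cmat CK *v (resolvent (cmat AK) t *v cvec (BK *v b)) + cvec (DK *v b) =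
        cmat CK' *v (resolvent (cmat AK') t *v cvec (BK' *v b)) + cvec (DK' *v b)"
      using arg_cong[OF tf_eq, of "\<lambda>T. T *v cvec b"] by (simp add: tf_mult_cvec)
  qed
  have "DK *v b = DK' *v b" for b
    using markov_parameters_unique(1)[OF eq[of b]] by simp
  then show "DK' = DK" by (simp add: matrix_eq)
  show "CK' *v ((((*v) AK') ^^ N) (BK' *v b)) = CK *v ((((*v) AK) ^^ N) (BK *v b))"
    using markov_parameters_unique(2)[OF eq[of b], of N] by (simp add: cmat_funpow_cvec cmat_mult_cvec)
qed

section \<open>Closed-loop states, Minkowski sums and Pontryagin differences\<close>

lemma projx_stack [simp]: "projx (stack x z) = x"
  by (simp add: projx_def stack_def)

lemma projk_stack [simp]: "projk (stack x z) = z"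
  by (simp add: projk_def stack_def)

lemma stack_projx_projk: "stack (projx \<xi>) (projk \<xi>) = \<xi>"
  by (simp add: vec_eq_iff stack_def projx_def projk_def split: sum.split)

lemma stack_add: "stack x z + stack x' z' = stack (x + x') (z + z')"
  by (simp add: vec_eq_iff stack_def split: sum.split)

lemma projx_add: "projx (\<xi> + \<zeta>) = projx \<xi> + projx \<zeta>"
  by (simp add: projx_def vec_eq_iff)

lemma projx_zero [simp]: "projx 0 = 0"
  by (simp add: projx_def vec_eq_iff)

lemma projx_sum: "projx (sum f I) = (\<Sum>i\<in>I. projx (f i))"
  by (induction I rule: infinite_finite_induct) (simp_all add: projx_add)

lemma norm_stack_squared: "(norm (stack x z))\<^sup>2 = (norm x)\<^sup>2 + (norm z)\<^sup>2"
  by (simp add: power2_norm_eq_inner inner_vec_def stack_def sum.Plus flip: UNIV_Plus_UNIV)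

lemma norm_stack_0 [simp]: "norm (stack x 0) = norm x"
  using norm_stack_squared[of x 0] by (simp add: power2_eq_iff_nonneg)

lemma norm_projx_le: "norm (projx \<xi>) \<le> norm \<xi>"
  using norm_stack_squared[of "projx \<xi>" "projk \<xi>"]
  by (simp add: stack_projx_projk power2_le_imp_le)

lemma ACL_mult_stack:
  "ACL A B AK BK CK DK *v stack x z = stack ((A + B ** DK) *v x + (B ** CK) *v z) (BK *v x + AK *v z)"
  by (simp add: vec_eq_iff ACL_def stack_def matrix_vector_mult_def sum.Plus
      UNIV_Plus_UNIV[symmetric] split: sum.split del: UNIV_Plus_UNIV)

lemma convex_pdiff: "convex C \<Longrightarrow> convex (C \<ominus>\<^sub>P B)"
  for C :: "'a::real_vector set"
  unfolding convex_def pdiff_def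
proof clarsimp
  fix x y b :: 'a and u v :: real
  assume C: "\<forall>x\<in>C. \<forall>y\<in>C. \<forall>u\<ge>0. \<forall>v\<ge>0. u + v = 1 \<longrightarrow> u *\<^sub>R x + v *\<^sub>R y \<in> C"
    and x: "\<forall>b\<in>B. x + b \<in> C" and y: "\<forall>b\<in>B. y + b \<in> C"
    and uv: "0 \<le> u" "0 \<le> v" "u + v = 1" and b: "b \<in> B"
  have "u *\<^sub>R (x + b) + v *\<^sub>R (y + b) \<in> C" using C x y uv b by blast
  moreover have "u *\<^sub>R (x + b) + v *\<^sub>R (y + b) = u *\<^sub>R x + v *\<^sub>R y + b"
    using uv by (simp add: algebra_simps flip: scaleR_add_left)
  ultimately show "u *\<^sub>R x + v *\<^sub>R y + b \<in> C" by simp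
qed

lemma pdiff_mono: "C \<subseteq> C' \<Longrightarrow> C \<ominus>\<^sub>P B \<subseteq> C' \<ominus>\<^sub>P B"
  unfolding pdiff_def by blast

lemma pdiff_msum_add:
  assumes "x \<in> C \<ominus>\<^sub>P (B \<oplus>\<^sub>M E)" "e \<in> E"
  shows "x + e \<in> C \<ominus>\<^sub>P B"
  unfolding pdiff_def
proof (intro CollectI ballI)
  fix b assume "b \<in> B"
  then have "x + (b + e) \<in> C"
    using assms unfolding pdiff_def msum_def by blast
  then show "x + e + b \<in> C" by (simp add: ac_simps)
qed

lemma pdiff_uminus_mem: "y \<in> C \<ominus>\<^sub>P uminus ` V \<Longrightarrow> v \<in> V \<Longrightarrow> y - v \<in> C"
  unfolding pdiff_def by force

lemma msums_mem: "(\<And>i. i \<le> M \<Longrightarrow> g i \<in> F i) \<Longrightarrow> (\<Sum>i\<le>M. g i) \<in> msums F M"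
  by (induction M) (auto simp: msum_def)

lemma bounded_msum: "bounded P \<Longrightarrow> bounded Q \<Longrightarrow> bounded (P \<oplus>\<^sub>M Q)"
  for P :: "'a::real_normed_vector set"
proof -
  assume "bounded P" "bounded Q"
  then obtain a b where a: "\<forall>x\<in>P. norm x \<le> a" and b: "\<forall>x\<in>Q. norm x \<le> b"
    unfolding bounded_iff by blast
  have "\<forall>x\<in>P \<oplus>\<^sub>M Q. norm x \<le> a + b"
    using a b by (auto simp: msum_def intro!: order_trans[OF norm_triangle_ineq] add_mono)
  then show ?thesis unfolding bounded_iff by blast
qed

lemma scaleR_image_subset_convex:
  assumes "convex S" "0 \<in> S" "0 \<le> c" "c \<le> 1"
  shows "(*\<^sub>R) c ` S \<subseteq> S"
proof
  fix z assume "z \<in> (*\<^sub>R) c ` S"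
  then obtain q where q: "q \<in> S" "z = c *\<^sub>R q" by blast
  have "c *\<^sub>R q + (1 - c) *\<^sub>R 0 \<in> S"
    using assms q(1) by (intro convexD) auto
  then show "z \<in> S" using q(2) by simp
qed

lemma convex_add_scaled_mem:
  fixes P :: "'a::real_normed_vector set"
  assumes "convex P" "cball 0 \<alpha> \<subseteq> P" "0 \<le> \<beta>" "\<beta> < 1" "norm a \<le> \<alpha> * (1 - \<beta>)" "p \<in> P"
  shows "a + \<beta> *\<^sub>R p \<in> P"
proof -
  have "(1 / (1 - \<beta>)) *\<^sub>R a \<in> cball 0 \<alpha>"
    using assms(4,5) by (simp add: field_simps)
  then have "(1 - \<beta>) *\<^sub>R ((1 / (1 - \<beta>)) *\<^sub>R a) + \<beta> *\<^sub>R p \<in> P"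
    using assms by (intro convexD) auto
  then show ?thesis using assms(4) by simp
qed

lemma linear_recurrence_solution:
  assumes L: "linear L" and step: "\<And>j. j < n \<Longrightarrow> z (Suc j) = L (z j) + f j"
  shows "z n = (L ^^ n) (z 0) + (\<Sum>i<n. (L ^^ (n - 1 - i)) (f i))"
  using step
proof (induction n)
  case (Suc n)
  have "L (\<Sum>i<n. (L ^^ (n - 1 - i)) (f i)) = (\<Sum>i<n. (L ^^ (Suc n - 1 - i)) (f i))"
    unfolding linear_sum[OF L]
  proof (rule sum.cong)
    fix i assume "i \<in> {..<n}"
    then have "Suc n - 1 - i = Suc (n - 1 - i)" by auto
    then show "L ((L ^^ (n - 1 - i)) (f i)) = (L ^^ (Suc n - 1 - i)) (f i)" by simp
  qed simp
  then show ?case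
    using Suc by (simp add: linear_add[OF L])
qed simp

lemma funpow_matrix_zero [simp]: "(((*v) M) ^^ k) 0 = 0"
  for M :: "'a::semiring_1^'n^'n"
  by (induction k) simp_all

section \<open>Runs of Algorithm 1\<close>

locale algorithm1_run =
  fixes A :: "real^'n^'n" and B :: "real^'m^'n" and D W V S :: "(real^'n) set" and OmI :: "(real^'n) set"
    and Ah :: "real^'l^'l" and Bh :: "real^'n^'l" and Ch :: "real^'l^'m" and Dh :: "real^'n^'m"
    and k0 :: nat and x y :: "nat \<Rightarrow> real^'n" and sg :: "nat \<Rightarrow> nat" and u :: "nat \<Rightarrow> real^'m"
    and xh :: "nat \<Rightarrow> real^'l" and d w v :: "nat \<Rightarrow> real^'n"
  assumes init: "x k0 \<in> convex hull (S \<union> (((*v) A ` S) \<oplus>\<^sub>M W \<oplus>\<^sub>M D))"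
    and plant: "plant A B D W V k0 x y sg u d w v"
    and alg: "algorithm1 S V OmI Ah Bh Ch Dh k0 y sg u xh"
begin

abbreviation S_c :: "(real^'n) set" where
  "S_c \<equiv> convex hull (S \<union> (((*v) A ` S) \<oplus>\<^sub>M W \<oplus>\<^sub>M D))"

lemma plant_at:
  assumes "k0 \<le> k"
  shows "d k \<in> D" "w k \<in> W" "v k \<in> V" "y k = x k + v k"
    "x (Suc k) = A *v x k + real (sg k) *\<^sub>R (B *v u k) + (1 - real (sg k)) *\<^sub>R d k + w k"
  using plant assms unfolding plant_def by auto

lemma initial_step:
  "y k0 \<in> S \<ominus>\<^sub>P uminus ` V \<Longrightarrow> sg k0 = 0 \<and> u k0 = 0"
  "y k0 \<notin> S \<ominus>\<^sub>P uminus ` V \<Longrightarrow> sg k0 = 1 \<and> xh k0 = 0"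
  using alg unfolding algorithm1_def by blast+

lemma monitoring_step:
  assumes "k0 < k"
  shows "if y k \<in> S \<ominus>\<^sub>P uminus ` V then
      (if sg (k - 1) = 1 \<and> y k \<notin> OmI \<ominus>\<^sub>P uminus ` V then sg k = 1 else sg k = 0 \<and> u k = 0)
    else (sg (k - 1) = 0 \<longrightarrow> xh k = 0) \<and> sg k = 1"
  using alg assms unfolding algorithm1_def by blast

lemma control_step:
  assumes "k0 \<le> k" "sg k = 1"
  shows "u k = Ch *v xh k + Dh *v y k" "xh (Suc k) = Ah *v xh k + Bh *v y k"
  using alg assms unfolding algorithm1_def by blast+

lemma sg_cases:
  assumes "k0 \<le> k"
  shows "sg k = 0 \<or> sg k = 1"
proof (cases "k = k0")
  case True
  then show ?thesis using initial_step by (cases "y k0 \<in> S \<ominus>\<^sub>P uminus ` V") auto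
next
  case False
  with assms have "k0 < k" by simp
  then show ?thesis using monitoring_step[of k] by (auto split: if_splits)
qed

lemma monitoring_measurement:
  assumes "k0 \<le> k" "sg k = 0"
  shows "y k \<in> S \<ominus>\<^sub>P uminus ` V \<and> u k = 0"
proof (cases "k = k0")
  case True
  then show ?thesis using initial_step assms(2) by (cases "y k0 \<in> S \<ominus>\<^sub>P uminus ` V") auto
next
  case False
  with assms have "k0 < k" by simp
  then show ?thesis using monitoring_step[of k] assms(2) by (auto split: if_splits)
qed

lemma monitoring_state_in_S:
  assumes "k0 \<le> k" "sg k = 0"
  shows "x k \<in> S"
proof -
  have "y k - v k \<in> S"
    using monitoring_measurement[OF assms] plant_at(3)[OF assms(1)] by (blast intro: pdiff_uminus_mem)
  then show ?thesis using plant_at(4)[OF assms(1)] by simp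
qed

lemma switch_to_monitoring:
  assumes "OmI \<subseteq> S" "k0 < k" "y k \<in> OmI \<ominus>\<^sub>P uminus ` V"
  shows "sg k = 0"
proof -
  have "y k \<in> S \<ominus>\<^sub>P uminus ` V" using assms(3) pdiff_mono[OF assms(1)] by blast
  then show ?thesis using monitoring_step[OF assms(2)] assms(3) by simp
qed

definition episode_start :: "nat \<Rightarrow> bool" where
  "episode_start s \<longleftrightarrow> k0 \<le> s \<and> sg s = 1 \<and> (s = k0 \<or> sg (s - 1) = 0)"

lemma episode_start_reset:
  assumes "episode_start s"
  shows "xh s = 0"
proof (cases "s = k0")
  case True
  then show ?thesis using assms initial_step unfolding episode_start_def
    by (cases "y k0 \<in> S \<ominus>\<^sub>P uminus ` V") auto
next
  case False
  with assms have "k0 < s" "sg s = 1" "sg (s - 1) = 0" unfolding episode_start_def by auto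
  then show ?thesis using monitoring_step[of s] by (auto split: if_splits)
qed

lemma episode_start_in_S_c:
  assumes "episode_start s"
  shows "x s \<in> S_c"
proof (cases "s = k0")
  case False
  then obtain k where k: "s = Suc k" "k0 \<le> k" "sg k = 0"
    using assms unfolding episode_start_def by (cases s) auto
  then have "x s = A *v x k + w k + d k"
    using plant_at(5)[OF k(2)] by simp
  moreover have "A *v x k + w k + d k \<in> ((*v) A ` S) \<oplus>\<^sub>M W \<oplus>\<^sub>M D"
    using monitoring_state_in_S[OF k(2,3)] plant_at[OF k(2)] unfolding msum_def by blast
  ultimately show ?thesis by (simp add: hull_inc)
qed (use init in simp)

lemma episode_start_exists:
  assumes "k0 \<le> k" "sg k = 1"
  shows "\<exists>s\<le>k. episode_start s \<and> (\<forall>i\<in>{s..k}. sg i = 1)"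
  using assms
proof (induction k)
  case 0
  then have "episode_start 0" unfolding episode_start_def by simp
  with 0 show ?case by auto
next
  case (Suc k)
  show ?case
  proof (cases "Suc k = k0 \<or> sg k = 0")
    case True
    with Suc.prems show ?thesis by (intro exI[of _ "Suc k"]) (auto simp: episode_start_def)
  next
    case False
    then have "k0 \<le> k" "sg k = 1" using Suc.prems sg_cases[of k] by auto
    with Suc.IH obtain s where "s \<le> k" "episode_start s" "\<forall>i\<in>{s..k}. sg i = 1" by blast
    with Suc.prems show ?thesis by (intro exI[of _ s]) (auto simp: le_Suc_eq)
  qed
qed

end

locale reference_run = algorithm1_run +
  fixes AK :: "real^'k^'k" and BK CK
  assumes markov: "\<And>N b. Ch *v ((((*v) Ah) ^^ N) (Bh *v b)) = CK *v ((((*v) AK) ^^ N) (BK *v b))"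
begin

definition active_for :: "nat \<Rightarrow> nat \<Rightarrow> bool" where
  "active_for s j \<longleftrightarrow> episode_start s \<and> (\<forall>i<j. sg (s + i) = 1)"

text \<open>The state that the reference realization \<open>(AK, BK, CK, Dh)\<close> would have if it had been reset
  at the start \<open>s\<close> of an episode and driven by the same measurements.\<close>

fun ref_state where
  "ref_state s 0 = 0"
| "ref_state s (Suc j) = AK *v ref_state s j + BK *v y (s + j)"

definition loop_state where
  "loop_state s j = stack (x (s + j)) (ref_state s j)"

lemma active_for_le: "active_for s j \<Longrightarrow> i \<le> j \<Longrightarrow> active_for s i"
  unfolding active_for_def by auto

lemma controller_output:
  assumes "active_for s j"
  shows "Ch *v xh (s + j) = CK *v ref_state s j"
proof -
  have s: "k0 \<le> s" "xh s = 0" and on: "\<And>i. i < j \<Longrightarrow> sg (s + i) = 1"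
    using assms episode_start_reset unfolding active_for_def episode_start_def by auto
  have "xh (s + j) = (\<Sum>i<j. (((*v) Ah) ^^ (j - 1 - i)) (Bh *v y (s + i)))"
    using linear_recurrence_solution[OF matrix_vector_mul_linear, of j "\<lambda>i. xh (s + i)"]
      control_step(2)[of "s + _"] s on by simp
  moreover have "ref_state s j = (\<Sum>i<j. (((*v) AK) ^^ (j - 1 - i)) (BK *v y (s + i)))"
    using linear_recurrence_solution[OF matrix_vector_mul_linear, of j "ref_state s"] by simp
  ultimately show ?thesis
    by (simp add: linear_sum[OF matrix_vector_mul_linear] markov)
qed

lemma loop_input:
  assumes "active_for s (Suc j)"
  shows "u (s + j) = CCL CK Dh (loop_state s j) + DCL Dh (w (s + j), v (s + j))"
proof -
  have k: "k0 \<le> s + j" and on: "sg (s + j) = 1"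
    using assms unfolding active_for_def episode_start_def by auto
  have "u (s + j) = CK *v ref_state s j + Dh *v (x (s + j) + v (s + j))"
    using control_step(1)[OF k on] controller_output[OF active_for_le[OF assms]] plant_at(4)[OF k] by simp
  then show ?thesis
    by (simp add: CCL_def DCL_def loop_state_def matrix_vector_right_distrib algebra_simps)
qed

lemma loop_step:
  assumes "active_for s (Suc j)"
  shows "loop_state s (Suc j) = ACL A B AK BK CK Dh *v loop_state s j + BCL B BK Dh (w (s + j), v (s + j))"
proof -
  have k: "k0 \<le> s + j" and on: "sg (s + j) = 1"
    using assms unfolding active_for_def episode_start_def by auto
  let ?x = "x (s + j)" and ?r = "ref_state s j" and ?w = "w (s + j)" and ?v = "v (s + j)"
  have "u (s + j) = Dh *v ?x + CK *v ?r + Dh *v ?v"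
    using loop_input[OF assms] by (simp add: CCL_def DCL_def loop_state_def)
  then have "x (s + Suc j) = (A + B ** Dh) *v ?x + (B ** CK) *v ?r + (?w + B *v (Dh *v ?v))"
    using plant_at(5)[OF k] on
    by (simp add: matrix_vector_mult_add_rdistrib matrix_vector_right_distrib ac_simps
        flip: matrix_vector_mul_assoc)
  moreover have "ref_state s (Suc j) = (BK *v ?x + AK *v ?r) + BK *v ?v"
    using plant_at(4)[OF k] by (simp add: matrix_vector_right_distrib ac_simps)
  ultimately show ?thesis
    by (simp add: loop_state_def ACL_mult_stack BCL_def stack_add ac_simps)
qed

lemma loop_state_formula:
  assumes "active_for s j"
  shows "loop_state s j = (((*v) (ACL A B AK BK CK Dh)) ^^ j) (stack (x s) 0) +
    (\<Sum>i<j. (((*v) (ACL A B AK BK CK Dh)) ^^ (j - 1 - i)) (BCL B BK Dh (w (s + i), v (s + i))))"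
  using linear_recurrence_solution[OF matrix_vector_mul_linear, of j "loop_state s"]
    loop_step active_for_le[OF assms] by (simp add: loop_state_def)

lemma loop_state_invariant:
  assumes O1: "\<forall>z\<in>S_c. stack z 0 \<in> OmO"
    and O2: "((*v) (ACL A B AK BK CK Dh) ` OmO) \<oplus>\<^sub>M (BCL B BK Dh ` (W \<times> V)) \<subseteq> OmO"
    and "active_for s j"
  shows "loop_state s j \<in> OmO"
  using assms(3)
proof (induction j)
  case 0
  then show ?case
    using O1 episode_start_in_S_c unfolding active_for_def loop_state_def by simp
next
  case (Suc j)
  have k: "k0 \<le> s + j"
    using Suc.prems unfolding active_for_def episode_start_def by simp
  have "ACL A B AK BK CK Dh *v loop_state s j \<in> (*v) (ACL A B AK BK CK Dh) ` OmO"
    by (rule imageI[OF Suc.IH[OF active_for_le[OF Suc.prems]]]) simp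
  moreover have "BCL B BK Dh (w (s + j), v (s + j)) \<in> BCL B BK Dh ` (W \<times> V)"
    using plant_at(2,3)[OF k] by (intro imageI SigmaI)
  ultimately show ?case
    using O2 loop_step[OF Suc.prems] unfolding msum_def by blast
qed

lemma run_safe:
  assumes U0: "0 \<in> U" and SX: "S \<subseteq> X"
    and O1: "\<forall>z\<in>S_c. stack z 0 \<in> OmO"
    and O2: "((*v) (ACL A B AK BK CK Dh) ` OmO) \<oplus>\<^sub>M (BCL B BK Dh ` (W \<times> V)) \<subseteq> OmO"
    and O3: "projx ` OmO \<subseteq> X"
    and O4: "(CCL CK Dh ` OmO) \<oplus>\<^sub>M (DCL Dh ` (W \<times> V)) \<subseteq> U"
    and k: "k0 \<le> k"
  shows "x k \<in> X \<and> u k \<in> U"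
proof (cases "sg k = 0")
  case True
  then show ?thesis
    using monitoring_state_in_S[OF k] monitoring_measurement[OF k] SX U0 by auto
next
  case False
  then have "sg k = 1" using sg_cases[OF k] by simp
  then obtain s where s: "s \<le> k" "episode_start s" "\<forall>i\<in>{s..k}. sg i = 1"
    using episode_start_exists[OF k] by blast
  define j where "j = k - s"
  have kj: "k = s + j" using s(1) by (simp add: j_def)
  have act: "active_for s (Suc j)"
    using s kj unfolding active_for_def by auto
  have inv: "loop_state s j \<in> OmO"
    by (rule loop_state_invariant[OF O1 O2 active_for_le[OF act]]) simp
  have "x k = projx (loop_state s j)" by (simp add: loop_state_def kj)
  moreover have "w k \<in> W" "v k \<in> V" using plant_at[OF k] by auto
  ultimately show ?thesis
    using O3 O4 inv loop_input[OF act] unfolding kj msum_def by blast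
qed

lemma control_reaches_terminal_set:
  fixes \<alpha> \<beta> :: real
  defines "P \<equiv> OmI \<ominus>\<^sub>P (uminus ` V \<oplus>\<^sub>M V)"
  assumes conv: "convex P" and \<alpha>: "cball 0 \<alpha> \<subseteq> P"
    and \<beta>: "0 \<le> \<beta>" "\<beta> < 1"
      "msums (\<lambda>i. projx ` ((\<lambda>z. ((*v) (ACL A B AK BK CK Dh) ^^ i) (BCL B BK Dh z)) ` (W \<times> V))) (N - 1)
        \<subseteq> (*\<^sub>R) \<beta> ` P"
    and decay: "\<forall>z\<in>S_c. norm (projx ((((*v) (ACL A B AK BK CK Dh)) ^^ N) (stack z 0))) \<le> \<alpha> * (1 - \<beta>)"
    and N: "0 < N" and act: "active_for s N"
  shows "x (s + N) \<in> P"
proof -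
  txt \<open>The state splits into the free response \<open>a\<close>, small by \<open>decay\<close>, and the response to the
    disturbances, which lies in \<open>\<beta> P\<close>.\<close>
  let ?M = "ACL A B AK BK CK Dh" and ?f = "\<lambda>i. BCL B BK Dh (w (s + i), v (s + i))"
  define a where "a = projx ((((*v) ?M) ^^ N) (stack (x s) 0))"
  define g where "g i = projx ((((*v) ?M) ^^ i) (?f (N - 1 - i)))" for i
  have "x (s + N) = projx (loop_state s N)" by (simp add: loop_state_def)
  also have "\<dots> = a + (\<Sum>i<N. g (N - Suc i))"
    using loop_state_formula[OF act] by (simp add: a_def g_def projx_add projx_sum)
  also have "\<dots> = a + (\<Sum>i\<le>N - 1. g i)"
    using N by (simp add: sum.nat_diff_reindex lessThan_Suc_atMost[symmetric])
  finally have x: "x (s + N) = a + (\<Sum>i\<le>N - 1. g i)" .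
  have k0: "k0 \<le> s" using act unfolding active_for_def episode_start_def by simp
  have "(\<Sum>i\<le>N - 1. g i) \<in> (*\<^sub>R) \<beta> ` P"
    using \<beta>(3) msums_mem[of "N - 1" g] plant_at(2,3)[of "s + _"] k0 unfolding g_def by fastforce
  then obtain p where "p \<in> P" "(\<Sum>i\<le>N - 1. g i) = \<beta> *\<^sub>R p" by blast
  moreover have "norm a \<le> \<alpha> * (1 - \<beta>)"
    using decay episode_start_in_S_c act unfolding a_def active_for_def by blast
  ultimately show ?thesis
    using convex_add_scaled_mem[OF conv \<alpha> \<beta>(1,2)] x by simp
qed

lemma episode_ends_within:
  fixes \<alpha> \<beta> :: real
  defines "P \<equiv> OmI \<ominus>\<^sub>P (uminus ` V \<oplus>\<^sub>M V)"
  assumes OmIS: "OmI \<subseteq> S" and conv: "convex P" and \<alpha>: "cball 0 \<alpha> \<subseteq> P"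
    and \<beta>: "0 \<le> \<beta>" "\<beta> < 1"
      "msums (\<lambda>i. projx ` ((\<lambda>z. ((*v) (ACL A B AK BK CK Dh) ^^ i) (BCL B BK Dh z)) ` (W \<times> V))) (N - 1)
        \<subseteq> (*\<^sub>R) \<beta> ` P"
    and decay: "\<forall>z\<in>S_c. norm (projx ((((*v) (ACL A B AK BK CK Dh)) ^^ N) (stack z 0))) \<le> \<alpha> * (1 - \<beta>)"
    and N: "0 < N" and start: "episode_start s"
  shows "\<exists>T\<in>{1..N}. sg (s + T) = 0"
proof (rule ccontr)
  assume no_exit: "\<not> (\<exists>T\<in>{1..N}. sg (s + T) = 0)"
  have k0: "k0 \<le> s" "sg s = 1" using start unfolding episode_start_def by auto
  have "sg (s + i) = 1" if "i < N" for i
  proof (cases "i = 0")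
    case False
    with that have "sg (s + i) \<noteq> 0" using no_exit by auto
    then show ?thesis using sg_cases[of "s + i"] k0 by auto
  qed (use k0 in simp)
  then have "active_for s N" using start unfolding active_for_def by blast
  then have "x (s + N) \<in> P"
    using control_reaches_terminal_set[OF conv[unfolded P_def] \<alpha>[unfolded P_def] \<beta>[unfolded P_def] decay N]
    unfolding P_def by blast
  then have "y (s + N) \<in> OmI \<ominus>\<^sub>P uminus ` V"
    using pdiff_msum_add plant_at(3,4)[of "s + N"] k0 unfolding P_def by simp
  then have "sg (s + N) = 0"
    using switch_to_monitoring[OF OmIS] k0 N by simp
  moreover have "N \<in> {1..N}" using N by simp
  ultimately show False using no_exit by blast
qed

lemma run_guarantees:
  fixes \<alpha> \<beta> :: real
  defines "P \<equiv> OmI \<ominus>\<^sub>P (uminus ` V \<oplus>\<^sub>M V)"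
  assumes U0: "0 \<in> U" and SX: "S \<subseteq> X" and OmIS: "OmI \<subseteq> S"
    and O1: "\<forall>z\<in>S_c. stack z 0 \<in> OmO"
    and O2: "((*v) (ACL A B AK BK CK Dh) ` OmO) \<oplus>\<^sub>M (BCL B BK Dh ` (W \<times> V)) \<subseteq> OmO"
    and O3: "projx ` OmO \<subseteq> X"
    and O4: "(CCL CK Dh ` OmO) \<oplus>\<^sub>M (DCL Dh ` (W \<times> V)) \<subseteq> U"
    and conv: "convex P" and \<alpha>: "cball 0 \<alpha> \<subseteq> P"
    and \<beta>: "0 \<le> \<beta>" "\<beta> < 1"
      "msums (\<lambda>i. projx ` ((\<lambda>z. ((*v) (ACL A B AK BK CK Dh) ^^ i) (BCL B BK Dh z)) ` (W \<times> V))) (N - 1)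
        \<subseteq> (*\<^sub>R) \<beta> ` P"
    and decay: "\<forall>z\<in>S_c. norm (projx ((((*v) (ACL A B AK BK CK Dh)) ^^ N) (stack z 0))) \<le> \<alpha> * (1 - \<beta>)"
    and N: "0 < N"
  shows "(\<forall>k\<ge>k0. x k \<in> X \<and> u k \<in> U) \<and> (\<forall>k\<ge>k0. sg k = 0 \<longrightarrow> x k \<in> S) \<and>
    (sg k0 = 1 \<longrightarrow> (\<exists>T0\<in>{1..N}. sg (k0 + T0) = 0)) \<and>
    (\<forall>k>k0. sg k = 1 \<and> sg (k - 1) = 0 \<longrightarrow> (\<exists>T\<in>{1..N}. sg (k + T) = 0))"
proof (intro conjI allI impI)
  fix k assume "k0 \<le> k"
  then show "x k \<in> X" "u k \<in> U" using run_safe[OF U0 SX O1 O2 O3 O4] by simp_all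
next
  fix k assume "k0 \<le> k" "sg k = 0"
  then show "x k \<in> S" by (rule monitoring_state_in_S)
next
  note exit = episode_ends_within[OF OmIS conv[unfolded P_def] \<alpha>[unfolded P_def] \<beta>[unfolded P_def] decay N]
  show "\<exists>T0\<in>{1..N}. sg (k0 + T0) = 0" if "sg k0 = 1"
    using that by (intro exit) (simp add: episode_start_def)
  show "\<exists>T\<in>{1..N}. sg (k + T) = 0" if "k0 < k" "sg k = 1 \<and> sg (k - 1) = 0" for k
    using that by (intro exit) (simp add: episode_start_def)
qed

end

lemma bounded_convex_hull_one_step:
  fixes A :: "real^'n^'n"
  assumes "bounded S" "bounded W" "bounded D"
  shows "bounded (convex hull (S \<union> (((*v) A ` S) \<oplus>\<^sub>M W \<oplus>\<^sub>M D)))"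
  using assms by (intro bounded_convex_hull bounded_Un[THEN iffD2] conjI bounded_msum
      bounded_linear_image[OF _ matrix_vector_mul_bounded_linear])

lemma schur_projx_settles:
  fixes M :: "real^('n::finite + 'k::finite)^('n + 'k)" and K :: "(real^'n) set"
  assumes "schur M" "bounded K" "0 < e"
  obtains N where "0 < N" "\<forall>z\<in>K. norm (projx ((((*v) M) ^^ N) (stack z (0 :: real^'k)))) \<le> e"
proof -
  have "bounded ((\<lambda>z. stack z (0 :: real^'k)) ` K)"
    using assms(2) unfolding bounded_iff by auto
  then obtain N where N: "0 < N" "\<forall>\<xi>\<in>(\<lambda>z. stack z 0) ` K. norm ((((*v) M) ^^ N) \<xi>) \<le> e"
    by (rule schur_powers_eventually_small[OF assms(1) _ assms(3)])
  have "\<forall>z\<in>K. norm (projx ((((*v) M) ^^ N) (stack z (0 :: real^'k)))) \<le> e"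
  proof
    fix z assume "z \<in> K"
    then have "norm ((((*v) M) ^^ N) (stack z (0 :: real^'k))) \<le> e" using N(2) by blast
    then show "norm (projx ((((*v) M) ^^ N) (stack z (0 :: real^'k)))) \<le> e"
      by (rule order_trans[OF norm_projx_le])
  qed
  with N(1) show thesis by (rule that)
qed

theorem corollary1:
  fixes A :: "real^'n^'n" and B :: "real^'m^'n"
    and D W V S X :: "(real^'n) set" and U :: "(real^'m) set"
    and \<epsilon>p \<epsilon>m \<epsilon>s :: real
    and AK :: "real^'k^'k" and BK :: "real^'n^'k" and CK :: "real^'k^'m" and DK :: "real^'n^'m"
    and OmI :: "(real^'n) set" and OmO :: "(real^('n + 'k)) set"
    and AK' :: "real^'l^'l" and BK' :: "real^'n^'l" and CK' :: "real^'l^'m" and DK' :: "real^'n^'m"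
  assumes polyD: "polytope D" "0 \<in> interior D"
    and polyW: "polytope W" "0 \<in> interior W"
    and polyV: "polytope V" "0 \<in> interior V"
    and polyS: "polytope S" "0 \<in> interior S"
    and polyX: "polytope X" "0 \<in> interior X"
    and polyU: "polytope U" "0 \<in> interior U"
    and SX: "S \<subseteq> X"
    and eps: "0 < \<epsilon>p" "\<epsilon>p < 1" "0 < \<epsilon>m" "\<epsilon>m < 1"
    and Vp: "V \<subseteq> (*\<^sub>R) \<epsilon>p ` S"
    and Vm: "uminus ` V \<subseteq> (*\<^sub>R) \<epsilon>m ` S"
    and ballS: "\<exists>r>0. cball 0 r \<subseteq> S"
    and Splus: "((*v) A ` S) \<oplus>\<^sub>M W \<oplus>\<^sub>M D \<subseteq> X"
    and schurACL: "schur (ACL A B AK BK CK DK)"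
    and polyOI: "polyhedron OmI" "0 \<in> OmI"
    and polyOO: "polyhedron OmO" "0 \<in> OmO"
    and epss: "0 < \<epsilon>s" "\<epsilon>s < 1"
    and I1: "OmI \<subseteq> (*\<^sub>R) \<epsilon>s ` S"
    and I2: "\<exists>\<alpha>>0. cball 0 \<alpha> \<subseteq> OmI \<ominus>\<^sub>P (uminus ` V \<oplus>\<^sub>M V)"
    and I3: "\<exists>\<beta>. 0 < \<beta> \<and> \<beta> < 1 \<and>
              (\<forall>N. msums (\<lambda>i. projx ` ((\<lambda>z. ((*v) (ACL A B AK BK CK DK) ^^ i) (BCL B BK DK z)) ` (W \<times> V))) N
                     \<subseteq> (*\<^sub>R) \<beta> ` (OmI \<ominus>\<^sub>P (uminus ` V \<oplus>\<^sub>M V)))"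
    and O1: "\<forall>x\<in>convex hull (S \<union> (((*v) A ` S) \<oplus>\<^sub>M W \<oplus>\<^sub>M D)). stack x 0 \<in> OmO"
    and O2: "((*v) (ACL A B AK BK CK DK) ` OmO) \<oplus>\<^sub>M (BCL B BK DK ` (W \<times> V)) \<subseteq> OmO"
    and O3: "projx ` OmO \<subseteq> X"
    and O4: "(CCL CK DK ` OmO) \<oplus>\<^sub>M (DCL DK ` (W \<times> V)) \<subseteq> U"
    and realiz: "same_tf AK BK CK DK AK' BK' CK' DK'"
  shows
    "(\<forall>k0 x y sg u xh d w v.
        x k0 \<in> convex hull (S \<union> (((*v) A ` S) \<oplus>\<^sub>M W \<oplus>\<^sub>M D)) \<and>
        plant A B D W V k0 x y sg u d w v \<and>
        algorithm1 S V OmI AK' BK' CK' DK' k0 y sg u (xh :: nat \<Rightarrow> real^'l) \<longrightarrow>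
          (\<forall>k\<ge>k0. x k \<in> X \<and> u k \<in> U) \<and>
          (\<forall>k\<ge>k0. sg k = 0 \<longrightarrow> x k \<in> S)) \<and>
     (\<exists>Tmax::nat. Tmax > 0 \<and>
       (\<forall>k0 x y sg u xh d w v.
          x k0 \<in> convex hull (S \<union> (((*v) A ` S) \<oplus>\<^sub>M W \<oplus>\<^sub>M D)) \<and>
          plant A B D W V k0 x y sg u d w v \<and>
          algorithm1 S V OmI AK' BK' CK' DK' k0 y sg u (xh :: nat \<Rightarrow> real^'l) \<longrightarrow>
            (sg k0 = 1 \<longrightarrow> (\<exists>T0\<in>{1..Tmax}. sg (k0 + T0) = 0)) \<and>
            (\<forall>k>k0. sg k = 1 \<and> sg (k - 1) = 0 \<longrightarrow> (\<exists>T\<in>{1..Tmax}. sg (k + T) = 0))))"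
proof -
  let ?S_c = "convex hull (S \<union> (((*v) A ` S) \<oplus>\<^sub>M W \<oplus>\<^sub>M D))"
  have OmIS: "OmI \<subseteq> S"
    using I1 scaleR_image_subset_convex[OF polytope_imp_convex[OF polyS(1)]
        interior_subset[THEN subsetD, OF polyS(2)], of \<epsilon>s] epss by auto
  obtain \<alpha> where \<alpha>: "0 < \<alpha>" "cball 0 \<alpha> \<subseteq> OmI \<ominus>\<^sub>P (uminus ` V \<oplus>\<^sub>M V)" using I2 by blast
  obtain \<beta> where \<beta>: "0 < \<beta>" "\<beta> < 1"
    "\<forall>N. msums (\<lambda>i. projx ` ((\<lambda>z. ((*v) (ACL A B AK BK CK DK) ^^ i) (BCL B BK DK z)) ` (W \<times> V))) N
       \<subseteq> (*\<^sub>R) \<beta> ` (OmI \<ominus>\<^sub>P (uminus ` V \<oplus>\<^sub>M V))" using I3 by blast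
  have "0 < \<alpha> * (1 - \<beta>)" using \<alpha>(1) \<beta>(2) by simp
  then obtain N where N: "0 < N"
      "\<forall>z\<in>?S_c. norm (projx ((((*v) (ACL A B AK BK CK DK)) ^^ N) (stack z 0))) \<le> \<alpha> * (1 - \<beta>)"
    by (rule schur_projx_settles[OF schurACL bounded_convex_hull_one_step[OF polytope_imp_bounded[OF polyS(1)]
          polytope_imp_bounded[OF polyW(1)] polytope_imp_bounded[OF polyD(1)]]])
  have "(\<forall>k\<ge>k0. x k \<in> X \<and> u k \<in> U) \<and> (\<forall>k\<ge>k0. sg k = 0 \<longrightarrow> x k \<in> S) \<and>
      (sg k0 = 1 \<longrightarrow> (\<exists>T0\<in>{1..N}. sg (k0 + T0) = 0)) \<and>
      (\<forall>k>k0. sg k = 1 \<and> sg (k - 1) = 0 \<longrightarrow> (\<exists>T\<in>{1..N}. sg (k + T) = 0))"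
    if run: "x k0 \<in> ?S_c \<and> plant A B D W V k0 x y sg u d w v \<and> algorithm1 S V OmI AK' BK' CK' DK' k0 y sg u xh"
    for k0 x y sg u xh d w v
  proof -
    interpret reference_run A B D W V S OmI AK' BK' CK' DK k0 x y sg u xh d w v AK BK CK
      using run same_tf_imp_markov[OF realiz] by unfold_locales auto
    show ?thesis
      by (rule run_guarantees[OF interior_subset[THEN subsetD, OF polyU(2)] SX OmIS O1 O2 O3 O4
            convex_pdiff[OF polyhedron_imp_convex[OF polyOI(1)]] \<alpha>(2) less_imp_le[OF \<beta>(1)] \<beta>(2)
            \<beta>(3)[rule_format] N(2) N(1)])
  qed
  with N(1) show ?thesis by blast
qed

end
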